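(* Let $\mathfrak{a}$ be a derivation-type Lie affgebra over $\mathbb{F}$ isomorphic to $\mathfrak{a}(\mathfrak{g};\kappa\,\mathrm{id},\lambda,s)$ for some scalar $\kappa\in\mathbb{F}$. Set $\delta=\lambda-\kappa\,\mathrm{id}$ (a derivation of $\mathfrak g$). Then $\mathfrak{a}\cong\mathfrak{g}+\delta$ as Lie affgebras, where $\mathfrak{g}+\delta=\{x+\delta\mid x\in\mathfrak{g}\}$ is the Lie subaffgebra of $\mathfrak{a}(\mathfrak{g}(\delta);\kappa\,\mathrm{id},\kappa\,\mathrm{id},s+(1-\kappa)\delta)$.
   Context: $\mathbb{F}$ is a field of characteristic different from 2. For a Lie algebra $\mathfrak{g}$ over $\mathbb{F}$, linear endomorphisms $\kappa,\lambda$ of $\mathfrak{g}$ with $\lambda([a,b])=[\lambda(a),b]-[a,\kappa(b)]+[a,\lambda(b)]$ for all $a,b\in\mathfrak{g}$, and $s\in\mathfrak{g}$, $\mathfrak{a}(\mathfrak{g};\kappa,\lambda,s)$ denotes the Lie affgebra which is the vector space $\mathfrak{g}$ viewed as an affine space ($\langle a,b,c\rangle=a-b+c$, $\alpha\triangleright_a b=(1-\alpha)a+\alpha b$) with affine Lie bracket $\{a,b\}=[a,b]+\kappa(a)+\lambda(b-a)+s$. Up to isomorphism every Lie affgebra (an affine space with a bi-affine bracket $\{-,-\}$ satisfying $\{a,b\}-\{a,a\}+\{b,a\}=\{b,b\}$ and $\{a,\{b,c\}\}-\{a,\{a,a\}\}+\{b,\{c,a\}\}-\{b,\{b,b\}\}+\{c,\{a,b\}\}=\{c,\{c,c\}\}$)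 is of this form. Homomorphisms of Lie affgebras are affine maps preserving the brackets. A Lie subaffgebra is an affine subspace closed under the bracket. A Lie affgebra is derivation-type if it is isomorphic to some $\mathfrak{a}(\mathfrak{g};\kappa,\lambda,s)$ such that $\lambda-\kappa$ is a derivation of $\mathfrak{g}$. For a derivation $\delta$ of $\mathfrak{g}$, $\mathfrak{g}(\delta)=\{x+\alpha\delta\mid x\in\mathfrak{g},\alpha\in\mathbb{F}\}\cong\mathfrak{g}\oplus\mathbb{F}$ (with $\delta$ treated as a formal basis symbol spanning the summand $\mathbb{F}$) is the semidirect product Lie algebra with bracket $[x+\alpha\delta,y+\beta\delta]=[x,y]+\alpha\delta(y)-\beta\delta(x)$. *)

theory Defs
  imports "HOL-Algebra.Module"
begin

section \<open>Lie algebras over a field\<close>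

text \<open>
  Vector spaces over a field \<open>F\<close> are modules over \<open>F\<close>; the fields \<open>mult\<close> and \<open>one\<close> which the
  record \<open>module\<close> inherits from \<open>ring\<close> play no role.
\<close>

record ('f, 'v) lie_alg = "('f, 'v) module" +
  lie :: "'v \<Rightarrow> 'v \<Rightarrow> 'v"

locale lie_algebra = module F L + field F for F (structure) and L (structure) +
  assumes lie_closed:
      "\<lbrakk>x \<in> carrier L; y \<in> carrier L\<rbrakk> \<Longrightarrow> lie L x y \<in> carrier L"
    and lie_add_left:
      "\<lbrakk>x \<in> carrier L; y \<in> carrier L; z \<in> carrier L\<rbrakk> \<Longrightarrow>
        lie L (x \<oplus>\<^bsub>L\<^esub> y) z = lie L x z \<oplus>\<^bsub>L\<^esub> lie L y z"
    and lie_add_right: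
      "\<lbrakk>x \<in> carrier L; y \<in> carrier L; z \<in> carrier L\<rbrakk> \<Longrightarrow>
        lie L x (y \<oplus>\<^bsub>L\<^esub> z) = lie L x y \<oplus>\<^bsub>L\<^esub> lie L x z"
    and lie_smult_left:
      "\<lbrakk>\<alpha> \<in> carrier F; x \<in> carrier L; y \<in> carrier L\<rbrakk> \<Longrightarrow>
        lie L (\<alpha> \<odot>\<^bsub>L\<^esub> x) y = \<alpha> \<odot>\<^bsub>L\<^esub> lie L x y"
    and lie_smult_right:
      "\<lbrakk>\<alpha> \<in> carrier F; x \<in> carrier L; y \<in> carrier L\<rbrakk> \<Longrightarrow>
        lie L x (\<alpha> \<odot>\<^bsub>L\<^esub> y) = \<alpha> \<odot>\<^bsub>L\<^esub> lie L x y"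
    and lie_alternating:
      "x \<in> carrier L \<Longrightarrow> lie L x x = \<zero>\<^bsub>L\<^esub>"
    and jacobi:
      "\<lbrakk>x \<in> carrier L; y \<in> carrier L; z \<in> carrier L\<rbrakk> \<Longrightarrow>
        lie L x (lie L y z) \<oplus>\<^bsub>L\<^esub> lie L y (lie L z x) \<oplus>\<^bsub>L\<^esub> lie L z (lie L x y) = \<zero>\<^bsub>L\<^esub>"

text \<open>Endomorphisms are HOL functions of which only the values on the carrier matter.\<close>

definition linear_endo ::
  "('f, 'm) ring_scheme \<Rightarrow> ('f, 'v, 'n) lie_alg_scheme \<Rightarrow> ('v \<Rightarrow> 'v) \<Rightarrow> bool" where
  "linear_endo F L f \<longleftrightarrow>
    f \<in> carrier L \<rightarrow> carrier L \<and>
    (\<forall>x\<in>carrier L. \<forall>y\<in>carrier L. f (x \<oplus>\<^bsub>L\<^esub> y) = f x \<oplus>\<^bsub>L\<^esub> f y) \<and>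
    (\<forall>\<alpha>\<in>carrier F. \<forall>x\<in>carrier L. f (\<alpha> \<odot>\<^bsub>L\<^esub> x) = \<alpha> \<odot>\<^bsub>L\<^esub> f x)"

definition derivation ::
  "('f, 'm) ring_scheme \<Rightarrow> ('f, 'v, 'n) lie_alg_scheme \<Rightarrow> ('v \<Rightarrow> 'v) \<Rightarrow> bool" where
  "derivation F L d \<longleftrightarrow> linear_endo F L d \<and>
    (\<forall>x\<in>carrier L. \<forall>y\<in>carrier L. d (lie L x y) = lie L (d x) y \<oplus>\<^bsub>L\<^esub> lie L x (d y))"

definition scalar_endo :: "('f, 'v, 'n) lie_alg_scheme \<Rightarrow> 'f \<Rightarrow> 'v \<Rightarrow> 'v" where
  "scalar_endo L k = (\<lambda>x. k \<odot>\<^bsub>L\<^esub> x)"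

definition diff_endo :: "('f, 'v, 'n) lie_alg_scheme \<Rightarrow> ('v \<Rightarrow> 'v) \<Rightarrow> ('v \<Rightarrow> 'v) \<Rightarrow> 'v \<Rightarrow> 'v" where
  "diff_endo L f g = (\<lambda>x. f x \<ominus>\<^bsub>L\<^esub> g x)"

text \<open>
  The semidirect product \<open>\<gg>(\<delta>)\<close>, with \<open>x + \<alpha>\<delta>\<close> encoded as the pair \<open>(x, \<alpha>)\<close>; in particular
  \<open>\<delta>\<close> itself is \<open>(\<zero>, \<one>)\<close>.
\<close>

definition semidirect ::
  "('f, 'm) ring_scheme \<Rightarrow> ('f, 'v, 'n) lie_alg_scheme \<Rightarrow> ('v \<Rightarrow> 'v) \<Rightarrow> ('f, 'v \<times> 'f) lie_alg" where
  "semidirect F L d =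
    \<lparr>carrier = carrier L \<times> carrier F, mult = undefined, one = undefined,
     zero = (\<zero>\<^bsub>L\<^esub>, \<zero>\<^bsub>F\<^esub>),
     add = (\<lambda>(x, \<alpha>) (y, \<beta>). (x \<oplus>\<^bsub>L\<^esub> y, \<alpha> \<oplus>\<^bsub>F\<^esub> \<beta>)),
     smult = (\<lambda>c (x, \<alpha>). (c \<odot>\<^bsub>L\<^esub> x, c \<otimes>\<^bsub>F\<^esub> \<alpha>)),
     lie = (\<lambda>(x, \<alpha>) (y, \<beta>).
       (lie L x y \<oplus>\<^bsub>L\<^esub> \<alpha> \<odot>\<^bsub>L\<^esub> d y \<ominus>\<^bsub>L\<^esub> \<beta> \<odot>\<^bsub>L\<^esub> d x, \<zero>\<^bsub>F\<^esub>))\<rparr>"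

section \<open>Lie affgebras\<close>

text \<open>
  \<open>heap A a b c\<close> is \<open>\<langle>a, b, c\<rangle>\<close>, \<open>act A \<alpha> a b\<close> is \<open>\<alpha> \<triangleright>\<^sub>a b\<close>, and \<open>bracket A a b\<close> is \<open>{a, b}\<close>.
\<close>

record ('f, 'p) affgebra = "'p partial_object" +
  heap :: "'p \<Rightarrow> 'p \<Rightarrow> 'p \<Rightarrow> 'p"
  act :: "'f \<Rightarrow> 'p \<Rightarrow> 'p \<Rightarrow> 'p"
  bracket :: "'p \<Rightarrow> 'p \<Rightarrow> 'p"

text \<open>
  Affine spaces without reference to a vector space: a nonempty abelian heap with an action such
  that \<open>\<alpha> \<triangleright>\<^sub>a -\<close> and \<open>- \<triangleright>\<^sub>a b\<close> are heap morphisms (\<open>F\<close> being a heap with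
  \<open>\<langle>\<alpha>, \<beta>, \<gamma>\<rangle> = \<alpha> - \<beta> + \<gamma>\<close>), which is associative, unital and satisfies the base change property.
\<close>

locale affine_space = field F for F (structure) and A (structure) +
  assumes nonempty: "carrier A \<noteq> {}"
    and heap_closed:
      "\<lbrakk>a \<in> carrier A; b \<in> carrier A; c \<in> carrier A\<rbrakk> \<Longrightarrow> heap A a b c \<in> carrier A"
    and heap_assoc:
      "\<lbrakk>a \<in> carrier A; b \<in> carrier A; c \<in> carrier A; d \<in> carrier A; e \<in> carrier A\<rbrakk> \<Longrightarrow>
        heap A (heap A a b c) d e = heap A a b (heap A c d e)"
    and heap_malcev_left: "\<lbrakk>a \<in> carrier A; b \<in> carrier A\<rbrakk> \<Longrightarrow> heap A a a b = b"
    and heap_malcev_right: "\<lbrakk>a \<in> carrier A; b \<in> carrier A\<rbrakk> \<Longrightarrow> heap A b a a = b"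
    and heap_comm:
      "\<lbrakk>a \<in> carrier A; b \<in> carrier A; c \<in> carrier A\<rbrakk> \<Longrightarrow> heap A a b c = heap A c b a"
    and act_closed:
      "\<lbrakk>\<alpha> \<in> carrier F; a \<in> carrier A; b \<in> carrier A\<rbrakk> \<Longrightarrow> act A \<alpha> a b \<in> carrier A"
    and act_heap:
      "\<lbrakk>\<alpha> \<in> carrier F; a \<in> carrier A; b \<in> carrier A; c \<in> carrier A; d \<in> carrier A\<rbrakk> \<Longrightarrow>
        act A \<alpha> a (heap A b c d) = heap A (act A \<alpha> a b) (act A \<alpha> a c) (act A \<alpha> a d)"
    and act_scalar_heap:
      "\<lbrakk>\<alpha> \<in> carrier F; \<beta> \<in> carrier F; \<gamma> \<in> carrier F; a \<in> carrier A; b \<in> carrier A\<rbrakk> \<Longrightarrow>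
        act A (\<alpha> \<ominus>\<^bsub>F\<^esub> \<beta> \<oplus>\<^bsub>F\<^esub> \<gamma>) a b = heap A (act A \<alpha> a b) (act A \<beta> a b) (act A \<gamma> a b)"
    and act_assoc:
      "\<lbrakk>\<alpha> \<in> carrier F; \<beta> \<in> carrier F; a \<in> carrier A; b \<in> carrier A\<rbrakk> \<Longrightarrow>
        act A (\<alpha> \<otimes>\<^bsub>F\<^esub> \<beta>) a b = act A \<alpha> a (act A \<beta> a b)"
    and act_base_change:
      "\<lbrakk>\<alpha> \<in> carrier F; a \<in> carrier A; b \<in> carrier A; c \<in> carrier A\<rbrakk> \<Longrightarrow>
        act A \<alpha> a b = heap A (act A \<alpha> c b) (act A \<alpha> c a) a"
    and act_zero: "\<lbrakk>a \<in> carrier A; b \<in> carrier A\<rbrakk> \<Longrightarrow> act A \<zero>\<^bsub>F\<^esub> a b = a"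
    and act_one: "\<lbrakk>a \<in> carrier A; b \<in> carrier A\<rbrakk> \<Longrightarrow> act A \<one>\<^bsub>F\<^esub> a b = b"

definition affine_map ::
  "('f, 'm) ring_scheme \<Rightarrow> ('f, 'p, 'n) affgebra_scheme \<Rightarrow> ('f, 'q, 'k) affgebra_scheme \<Rightarrow>
    ('p \<Rightarrow> 'q) \<Rightarrow> bool" where
  "affine_map F A B f \<longleftrightarrow>
    f \<in> carrier A \<rightarrow> carrier B \<and>
    (\<forall>a\<in>carrier A. \<forall>b\<in>carrier A. \<forall>c\<in>carrier A. f (heap A a b c) = heap B (f a) (f b) (f c)) \<and>
    (\<forall>\<alpha>\<in>carrier F. \<forall>a\<in>carrier A. \<forall>b\<in>carrier A. f (act A \<alpha> a b) = act B \<alpha> (f a) (f b))"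

text \<open>
  The affine antisymmetry and Jacobi identities are stated with \<open>x - y + z\<close> read as
  \<open>\<langle>x, y, z\<rangle>\<close> and \<open>x - y + z - u + v\<close> as \<open>\<langle>\<langle>x, y, z\<rangle>, u, v\<rangle>\<close>.
\<close>

locale lie_affgebra = affine_space F A for F (structure) and A (structure) +
  assumes bracket_affine_left:
      "b \<in> carrier A \<Longrightarrow> affine_map F A A (\<lambda>a. bracket A a b)"
    and bracket_affine_right:
      "a \<in> carrier A \<Longrightarrow> affine_map F A A (\<lambda>b. bracket A a b)"
    and bracket_antisym:
      "\<lbrakk>a \<in> carrier A; b \<in> carrier A\<rbrakk> \<Longrightarrow>
        heap A (bracket A a b) (bracket A a a) (bracket A b a) = bracket A b b"
    and bracket_jacobi:
      "\<lbrakk>a \<in> carrier A; b \<in> carrier A; c \<in> carrier A\<rbrakk> \<Longrightarrow>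
        heap A
          (heap A (bracket A a (bracket A b c)) (bracket A a (bracket A a a))
                  (bracket A b (bracket A c a)))
          (bracket A b (bracket A b b))
          (bracket A c (bracket A a b))
        = bracket A c (bracket A c c)"

definition affgebra_iso ::
  "('f, 'm) ring_scheme \<Rightarrow> ('f, 'p, 'n) affgebra_scheme \<Rightarrow> ('f, 'q, 'k) affgebra_scheme \<Rightarrow> bool" where
  "affgebra_iso F A B \<longleftrightarrow>
    (\<exists>f. affine_map F A B f \<and> bij_betw f (carrier A) (carrier B) \<and>
      (\<forall>a\<in>carrier A. \<forall>b\<in>carrier A. f (bracket A a b) = bracket B (f a) (f b)))"

definition lie_subaffgebra ::
  "('f, 'm) ring_scheme \<Rightarrow> 'p set \<Rightarrow> ('f, 'p, 'n) affgebra_scheme \<Rightarrow> bool" where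
  "lie_subaffgebra F S A \<longleftrightarrow>
    lie_affgebra F A \<and> S \<noteq> {} \<and> S \<subseteq> carrier A \<and>
    (\<forall>a\<in>S. \<forall>b\<in>S. \<forall>c\<in>S. heap A a b c \<in> S) \<and>
    (\<forall>\<alpha>\<in>carrier F. \<forall>a\<in>S. \<forall>b\<in>S. act A \<alpha> a b \<in> S) \<and>
    (\<forall>a\<in>S. \<forall>b\<in>S. bracket A a b \<in> S)"

section \<open>The Lie affgebras \<open>\<aa>(\<gg>; \<kappa>, \<lambda>, s)\<close>\<close>

definition lie_affgebra_data ::
  "('f, 'm) ring_scheme \<Rightarrow> ('f, 'v, 'n) lie_alg_scheme \<Rightarrow> ('v \<Rightarrow> 'v) \<Rightarrow> ('v \<Rightarrow> 'v) \<Rightarrow> 'v \<Rightarrow> bool" where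
  "lie_affgebra_data F L kap lam s \<longleftrightarrow>
    lie_algebra F L \<and> linear_endo F L kap \<and> linear_endo F L lam \<and> s \<in> carrier L \<and>
    (\<forall>a\<in>carrier L. \<forall>b\<in>carrier L.
      lam (lie L a b) = lie L (lam a) b \<ominus>\<^bsub>L\<^esub> lie L a (kap b) \<oplus>\<^bsub>L\<^esub> lie L a (lam b))"

definition affgebra_of ::
  "('f, 'm) ring_scheme \<Rightarrow> ('f, 'v, 'n) lie_alg_scheme \<Rightarrow> ('v \<Rightarrow> 'v) \<Rightarrow> ('v \<Rightarrow> 'v) \<Rightarrow> 'v \<Rightarrow>
    ('f, 'v) affgebra" where
  "affgebra_of F L kap lam s =
    \<lparr>carrier = carrier L,
     heap = (\<lambda>a b c. a \<ominus>\<^bsub>L\<^esub> b \<oplus>\<^bsub>L\<^esub> c),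
     act = (\<lambda>\<alpha> a b. (\<one>\<^bsub>F\<^esub> \<ominus>\<^bsub>F\<^esub> \<alpha>) \<odot>\<^bsub>L\<^esub> a \<oplus>\<^bsub>L\<^esub> \<alpha> \<odot>\<^bsub>L\<^esub> b),
     bracket = (\<lambda>a b. lie L a b \<oplus>\<^bsub>L\<^esub> kap a \<oplus>\<^bsub>L\<^esub> lam (b \<ominus>\<^bsub>L\<^esub> a) \<oplus>\<^bsub>L\<^esub> s)\<rparr>"

text \<open>
  HOL cannot quantify existentially over types, so the Lie algebra witnessing derivation type is
  taken on the type of points of \<open>A\<close>. Nothing is lost: a Lie algebra on any other type for which
  such an isomorphism exists can be transported along it to the carrier of \<open>A\<close>.
\<close>

definition derivation_type ::
  "('f, 'm) ring_scheme \<Rightarrow> ('f, 'p, 'n) affgebra_scheme \<Rightarrow> bool" where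
  "derivation_type F A \<longleftrightarrow>
    (\<exists>(L :: ('f, 'p) lie_alg) kap lam s.
      lie_affgebra_data F L kap lam s \<and> derivation F L (diff_endo L lam kap) \<and>
      affgebra_iso F A (affgebra_of F L kap lam s))"

text \<open>The set \<open>\<gg> + \<delta>\<close> of all \<open>x + \<delta>\<close> inside \<open>\<gg>(\<delta>)\<close>.\<close>

definition delta_translate ::
  "('f, 'm) ring_scheme \<Rightarrow> ('f, 'v, 'n) lie_alg_scheme \<Rightarrow> ('v \<times> 'f) set" where
  "delta_translate F L = {(x, \<one>\<^bsub>F\<^esub>) | x. x \<in> carrier L}"

end

theory Submission
  imports Defs
begin

text \<open>
  In \<open>\<gg>(\<delta>)\<close> bracketing with the symbol \<open>\<delta>\<close> acts as the derivation \<open>\<delta>\<close>, and the elements whose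
  \<open>\<delta>\<close>-coefficient is one form an affine hyperplane \<open>\<gg> + \<delta>\<close> with direction \<open>\<gg>\<close>. For two of its
  points
  \<open>[x + \<delta>, y + \<delta>] = [x, y] + \<delta>(y - x)\<close>,
  so the Lie bracket of \<open>\<gg>(\<delta>)\<close> already supplies the term by which \<open>\<lambda>(y - x) = \<delta>(y - x) + \<kappa>(y - x)\<close>
  differs from \<open>\<kappa>(y - x)\<close>. Hence in \<open>\<aa>(\<gg>(\<delta>); \<kappa> id, \<kappa> id, s + (1 - \<kappa>)\<delta>)\<close>
  the bracket of \<open>x + \<delta>\<close> and \<open>y + \<delta>\<close> has the \<open>\<gg>\<close>-component \<open>[x, y] + \<kappa>x + \<lambda>(y - x) + s\<close>, which is the
  bracket of \<open>\<aa>(\<gg>; \<kappa> id, \<lambda>, s)\<close>, and its \<open>\<delta>\<close>-coefficient is \<open>\<kappa> + (1 - \<kappa>) = 1\<close>: the constant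
  \<open>(1 - \<kappa>)\<delta>\<close> is exactly what keeps the hyperplane closed. Thus \<open>x \<mapsto> x + \<delta>\<close> is the required isomorphism
  (\<open>bracket_at_height_one\<close>, \<open>affgebra_iso_delta_translate\<close>).

  For this to be meaningful, \<open>\<delta>\<close> has to be a derivation (\<open>derivation_diff_scalar\<close>), \<open>\<gg>(\<delta>)\<close> a Lie
  algebra (\<open>lie_algebra_semidirect\<close>), and \<open>\<aa>(\<gg>; \<kappa>, \<lambda>, s)\<close> a Lie affgebra in general
  (\<open>lie_affgebra_affgebra_of\<close>). The Jacobi identities behind the last two have the same shape: the
  nested bracket of \<open>a\<close>, \<open>b\<close>, \<open>c\<close> is \<open>[a, [b, c]]\<close> plus a difference \<open>K(b, c, a) - K(a, b, c)\<close> (plus a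
  term in \<open>a\<close> alone, in the affine case). Such differences telescope in the cyclic sum, which leaves
  the Jacobi identity of \<open>\<gg>\<close>.
\<close>

section \<open>Differences in abelian groups\<close>

context abelian_group
begin

lemma minus_eq_iff:
  assumes "x \<in> carrier G" "y \<in> carrier G" "z \<in> carrier G"
  shows "x \<ominus> y = z \<longleftrightarrow> x = z \<oplus> y"
  using assms unfolding a_minus_def by (metis add.inv_solve_right')

lemma eq_minus_iff:
  assumes "x \<in> carrier G" "y \<in> carrier G" "z \<in> carrier G"
  shows "z = x \<ominus> y \<longleftrightarrow> z \<oplus> y = x"
  using minus_eq_iff[OF assms] by auto

lemma add_minus:
  assumes "x \<in> carrier G" "y \<in> carrier G" "z \<in> carrier G"
  shows "x \<oplus> (y \<ominus> z) = (x \<oplus> y) \<ominus> z"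
  using assms unfolding a_minus_def by (simp add: a_assoc)

lemma minus_add_right:
  assumes "x \<in> carrier G" "y \<in> carrier G" "z \<in> carrier G"
  shows "(x \<ominus> y) \<oplus> z = (x \<oplus> z) \<ominus> y"
  using assms unfolding a_minus_def by (simp add: a_ac)

lemma minus_minus_left:
  assumes "x \<in> carrier G" "y \<in> carrier G" "z \<in> carrier G"
  shows "(x \<ominus> y) \<ominus> z = x \<ominus> (y \<oplus> z)"
  using assms unfolding a_minus_def by (simp add: a_ac minus_add)

lemma minus_minus_right:
  assumes "x \<in> carrier G" "y \<in> carrier G" "z \<in> carrier G"
  shows "x \<ominus> (y \<ominus> z) = (x \<oplus> z) \<ominus> y"
  using assms unfolding a_minus_def by (simp add: a_ac minus_add)

lemma add_a_inv:
  assumes "x \<in> carrier G" "y \<in> carrier G"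
  shows "x \<oplus> (\<ominus> y) = x \<ominus> y" "(\<ominus> y) \<oplus> x = x \<ominus> y"
  using assms unfolding a_minus_def by (simp_all add: a_ac)

lemma minus_a_inv:
  assumes "x \<in> carrier G" "y \<in> carrier G"
  shows "x \<ominus> (\<ominus> y) = x \<oplus> y" "(\<ominus> y) \<ominus> x = \<ominus> (x \<oplus> y)" "\<ominus> (x \<ominus> y) = y \<ominus> x"
  using assms unfolding a_minus_def by (simp_all add: a_ac minus_add)

lemma zero_minus: "x \<in> carrier G \<Longrightarrow> \<zero> \<ominus> x = \<ominus> x" "x \<in> carrier G \<Longrightarrow> x \<ominus> \<zero> = x"
  "x \<in> carrier G \<Longrightarrow> x \<ominus> x = \<zero>"
  by (simp_all add: a_minus_def r_neg)

lemma a_inv_eq_iff: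
  assumes "x \<in> carrier G" "z \<in> carrier G"
  shows "\<ominus> x = z \<longleftrightarrow> \<zero> = z \<oplus> x" "z = \<ominus> x \<longleftrightarrow> z \<oplus> x = \<zero>"
  using minus_eq_iff[of \<zero> x z] assms by (auto simp: zero_minus)

text \<open>
  These rules collect every sum into a single difference \<open>P \<ominus> Q\<close> and turn an equation between
  differences into one between sums, which associativity and commutativity then decide. Cancelling
  opposite terms directly would need them to be adjacent, which ordered rewriting does not ensure.
\<close>

lemmas difference_simps =
  minus_eq_iff eq_minus_iff add_minus minus_add_right minus_minus_left minus_minus_right
  add_a_inv minus_a_inv zero_minus a_inv_eq_iff

text \<open>
  The left-hand side of the affine Jacobi identity, where \<open>x\<close>, \<open>y\<close>, \<open>z\<close> stand for the diagonal terms
  such as \<open>{a, {a, a}}\<close>, and \<open>u\<close>, \<open>v\<close>, \<open>w\<close> for the deviations from them.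
\<close>

lemma telescope:
  assumes "u \<oplus> v \<oplus> w = \<zero>"
    and "u \<in> carrier G" "v \<in> carrier G" "w \<in> carrier G"
    and "x \<in> carrier G" "y \<in> carrier G" "z \<in> carrier G"
  shows "((x \<oplus> u) \<ominus> x \<oplus> (y \<oplus> v)) \<ominus> y \<oplus> (z \<oplus> w) = z"
proof -
  have "((x \<oplus> u) \<ominus> x \<oplus> (y \<oplus> v)) \<ominus> y \<oplus> (z \<oplus> w) = (u \<oplus> v \<oplus> w) \<oplus> z"
    using assms(2-7) by (simp add: difference_simps a_ac)
  then show ?thesis
    using assms by simp
qed

text \<open>
  With \<open>x\<close>, \<open>y\<close>, \<open>z\<close> the values of \<open>K\<close> at the cyclic shifts of a triple, the terms \<open>y - x\<close>, \<open>z - y\<close>,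
  \<open>x - z\<close> are the shifts of one difference and do not contribute to the cyclic sum.
\<close>

lemma cyclic_sum_coboundary:
  assumes "u \<oplus> v \<oplus> w = \<zero>"
    and "u \<in> carrier G" "v \<in> carrier G" "w \<in> carrier G"
    and "x \<in> carrier G" "y \<in> carrier G" "z \<in> carrier G"
  shows "(u \<oplus> (y \<ominus> x)) \<oplus> (v \<oplus> (z \<ominus> y)) \<oplus> (w \<oplus> (x \<ominus> z)) = \<zero>"
proof -
  have "(u \<oplus> (y \<ominus> x)) \<oplus> (v \<oplus> (z \<ominus> y)) \<oplus> (w \<oplus> (x \<ominus> z)) = u \<oplus> v \<oplus> w"
    using assms(2-7) by (simp add: difference_simps a_ac)
  then show ?thesis
    using assms(1) by simp
qed

end

section \<open>Scalars, linear endomorphisms and Lie brackets\<close>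

context module
begin

lemma smult_minus_left:
  assumes "a \<in> carrier R" "b \<in> carrier R" "x \<in> carrier M"
  shows "(a \<ominus> b) \<odot>\<^bsub>M\<^esub> x = a \<odot>\<^bsub>M\<^esub> x \<ominus>\<^bsub>M\<^esub> b \<odot>\<^bsub>M\<^esub> x"
  using assms by (simp add: R.minus_eq a_minus_def smult_l_distr smult_l_minus)

lemma smult_minus_right:
  assumes "a \<in> carrier R" "x \<in> carrier M" "y \<in> carrier M"
  shows "a \<odot>\<^bsub>M\<^esub> (x \<ominus>\<^bsub>M\<^esub> y) = a \<odot>\<^bsub>M\<^esub> x \<ominus>\<^bsub>M\<^esub> a \<odot>\<^bsub>M\<^esub> y"
  using assms by (simp add: a_minus_def smult_r_distr smult_r_minus)

lemma smult_left_commute: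
  assumes "a \<in> carrier R" "b \<in> carrier R" "x \<in> carrier M"
  shows "a \<odot>\<^bsub>M\<^esub> (b \<odot>\<^bsub>M\<^esub> x) = b \<odot>\<^bsub>M\<^esub> (a \<odot>\<^bsub>M\<^esub> x)"
  using assms by (simp add: smult_assoc1[symmetric] R.m_comm)

lemmas module_simps = smult_minus_left smult_minus_right smult_l_distr smult_r_distr smult_assoc1
  M.difference_simps M.a_ac

end

lemma linear_endoD:
  assumes "linear_endo F L f"
  shows "x \<in> carrier L \<Longrightarrow> f x \<in> carrier L"
    and "x \<in> carrier L \<Longrightarrow> y \<in> carrier L \<Longrightarrow> f (x \<oplus>\<^bsub>L\<^esub> y) = f x \<oplus>\<^bsub>L\<^esub> f y"
    and "\<alpha> \<in> carrier F \<Longrightarrow> x \<in> carrier L \<Longrightarrow> f (\<alpha> \<odot>\<^bsub>L\<^esub> x) = \<alpha> \<odot>\<^bsub>L\<^esub> f x"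
  using assms by (auto simp: linear_endo_def)

context lie_algebra
begin

lemma linear_endo_minus:
  assumes "linear_endo F L f" "x \<in> carrier L" "y \<in> carrier L"
  shows "f (x \<ominus>\<^bsub>L\<^esub> y) = f x \<ominus>\<^bsub>L\<^esub> f y"
proof -
  have "f (x \<ominus>\<^bsub>L\<^esub> y) \<oplus>\<^bsub>L\<^esub> f y = f ((x \<ominus>\<^bsub>L\<^esub> y) \<oplus>\<^bsub>L\<^esub> y)"
    using assms by (simp add: linear_endoD(2)[OF assms(1)])
  also have "(x \<ominus>\<^bsub>L\<^esub> y) \<oplus>\<^bsub>L\<^esub> y = x"
    using assms by (simp add: M.difference_simps M.a_ac)
  finally show ?thesis
    using assms by (simp add: linear_endoD(1)[OF assms(1)] M.difference_simps)
qed

lemma linear_endo_zero: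
  assumes "linear_endo F L f"
  shows "f \<zero>\<^bsub>L\<^esub> = \<zero>\<^bsub>L\<^esub>"
  using linear_endo_minus[OF assms, of "\<zero>\<^bsub>L\<^esub>" "\<zero>\<^bsub>L\<^esub>"] linear_endoD(1)[OF assms]
  by (simp add: M.zero_minus)

lemma linear_endo_scalar:
  assumes "k \<in> carrier F"
  shows "linear_endo F L (scalar_endo L k)"
  using assms by (auto simp: linear_endo_def scalar_endo_def smult_r_distr smult_left_commute)

lemma linear_endo_add:
  assumes f: "linear_endo F L f" and g: "linear_endo F L g"
  shows "linear_endo F L (\<lambda>x. f x \<oplus>\<^bsub>L\<^esub> g x)"
  using linear_endoD[OF f] linear_endoD[OF g]
  by (auto simp: linear_endo_def smult_r_distr M.a_ac)

lemma linear_endo_diff: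
  assumes f: "linear_endo F L f" and g: "linear_endo F L g"
  shows "linear_endo F L (diff_endo L f g)"
  using linear_endoD[OF f] linear_endoD[OF g]
  by (auto simp: linear_endo_def diff_endo_def module_simps)

lemma linear_endo_lie_left: "b \<in> carrier L \<Longrightarrow> linear_endo F L (\<lambda>a. lie L a b)"
  by (auto simp: linear_endo_def lie_closed lie_add_left lie_smult_left)

lemma linear_endo_lie_right: "a \<in> carrier L \<Longrightarrow> linear_endo F L (\<lambda>b. lie L a b)"
  by (auto simp: linear_endo_def lie_closed lie_add_right lie_smult_right)

lemma lie_antisym:
  assumes "x \<in> carrier L" "y \<in> carrier L"
  shows "lie L x y = \<ominus>\<^bsub>L\<^esub> lie L y x"
proof -
  have "lie L (x \<oplus>\<^bsub>L\<^esub> y) (x \<oplus>\<^bsub>L\<^esub> y) = \<zero>\<^bsub>L\<^esub>"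
    using assms by (simp add: lie_alternating)
  moreover have "lie L (x \<oplus>\<^bsub>L\<^esub> y) (x \<oplus>\<^bsub>L\<^esub> y) = lie L x y \<oplus>\<^bsub>L\<^esub> lie L y x"
    using assms
    by (simp add: lie_add_left lie_add_right lie_alternating[of x] lie_alternating[of y] lie_closed
        M.a_comm)
  ultimately have "lie L x y \<oplus>\<^bsub>L\<^esub> lie L y x = \<zero>\<^bsub>L\<^esub>"
    by simp
  then show ?thesis
    using assms by (simp add: lie_closed M.minus_equality)
qed

lemma lie_minus_right:
  assumes "x \<in> carrier L" "y \<in> carrier L" "z \<in> carrier L"
  shows "lie L z (x \<ominus>\<^bsub>L\<^esub> y) = lie L z x \<ominus>\<^bsub>L\<^esub> lie L z y"
  using linear_endo_minus[OF linear_endo_lie_right] assms by blast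

lemma lie_minus_left:
  assumes "x \<in> carrier L" "y \<in> carrier L" "z \<in> carrier L"
  shows "lie L (x \<ominus>\<^bsub>L\<^esub> y) z = lie L x z \<ominus>\<^bsub>L\<^esub> lie L y z"
  using linear_endo_minus[OF linear_endo_lie_left] assms by blast

end

section \<open>The Lie affgebra of a Lie algebra with data\<close>

context lie_algebra
begin

lemma affine_space_affgebra_of: "affine_space F (affgebra_of F L kap lam s)"
  by unfold_locales (auto simp: affgebra_of_def module_simps)

lemma affine_map_linear_plus_constant:
  assumes f: "linear_endo F L f" and c: "c \<in> carrier L"
    and h: "\<And>x. x \<in> carrier L \<Longrightarrow> h x = f x \<oplus>\<^bsub>L\<^esub> c"
  shows "affine_map F (affgebra_of F L kap lam s) (affgebra_of F L kap lam s) h"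
  using c
  by (auto simp: affine_map_def affgebra_of_def h linear_endoD[OF f] linear_endo_minus[OF f] module_simps)

end

text \<open>
  In each argument the bracket is a linear map plus a constant, hence affine.
  The diagonal part \<open>{a, {a, a}}\<close> of \<open>{a, {b, c}}\<close> absorbs all terms in which \<open>s\<close> occurs. The rest is
  \<open>[a, [b, c]]\<close> and a telescoping difference, by the compatibility of \<open>\<lambda>\<close> with the bracket: used on
  \<open>[b, c]\<close>, it replaces \<open>\<lambda>[b, c]\<close> by brackets of elements with values of \<open>\<kappa>\<close> and \<open>\<lambda>\<close>, and used on
  \<open>[a, a]\<close>, it gives \<open>[a, \<kappa>(a)] = 0\<close>, so that \<open>[a, s]\<close> is the only bracket left in the diagonal part.
\<close>

lemma lie_affgebra_affgebra_of:
  assumes data: "lie_affgebra_data F L kap lam s"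
  shows "lie_affgebra F (affgebra_of F L kap lam s)"
proof -
  interpret lie_algebra F L
    using data by (simp add: lie_affgebra_data_def)
  let ?A = "affgebra_of F L kap lam s"
  have kap: "linear_endo F L kap" and lam: "linear_endo F L lam" and s: "s \<in> carrier L"
    and lam_lie: "\<And>a b. a \<in> carrier L \<Longrightarrow> b \<in> carrier L \<Longrightarrow>
      lam (lie L a b) = lie L (lam a) b \<ominus>\<^bsub>L\<^esub> lie L a (kap b) \<oplus>\<^bsub>L\<^esub> lie L a (lam b)"
    using data by (auto simp: lie_affgebra_data_def)
  note closed = s linear_endoD(1)[OF kap] linear_endoD(1)[OF lam] lie_closed
  note expand = linear_endoD(2)[OF kap] linear_endoD(2)[OF lam]
    linear_endo_minus[OF kap] linear_endo_minus[OF lam] lie_add_right lie_minus_right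
  have br: "bracket ?A a b = lie L a b \<oplus>\<^bsub>L\<^esub> kap a \<oplus>\<^bsub>L\<^esub> lam (b \<ominus>\<^bsub>L\<^esub> a) \<oplus>\<^bsub>L\<^esub> s" for a b
    by (simp add: affgebra_of_def)
  have heap: "heap ?A a b c = a \<ominus>\<^bsub>L\<^esub> b \<oplus>\<^bsub>L\<^esub> c" for a b c
    by (simp add: affgebra_of_def)
  have carr: "carrier ?A = carrier L"
    by (simp add: affgebra_of_def)
  have lie_kap_self: "lie L a (kap a) = \<zero>\<^bsub>L\<^esub>" if a: "a \<in> carrier L" for a
    using lam_lie[OF a a] lie_antisym[of "lam a" a] a
    by (simp add: closed lie_alternating linear_endo_zero[OF lam] M.difference_simps)
  define D where "D a = bracket ?A a (bracket ?A a a)" for a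
  \<comment> \<open>Found by pairing each summand of the deviation of \<open>{a, {b, c}}\<close> from \<open>D a\<close> with one of opposite
    sign and cyclically shifted arguments: \<open>[a, \<kappa>(b)]\<close> with \<open>-[b, \<kappa>(c)]\<close>, \<open>[a, \<lambda>(c)]\<close> with
    \<open>-[c, \<lambda>(b)]\<close>, \<open>[b, \<lambda>(c)]\<close> with \<open>-[a, \<lambda>(b)]\<close>, \<open>\<lambda>\<kappa>(b)\<close> with \<open>-\<lambda>\<kappa>(a)\<close>, and \<open>\<lambda>\<lambda>(c)\<close> with
    \<open>-\<lambda>\<lambda>(b)\<close>.\<close>
  define K where "K a b c = (lie L c (lam b) \<oplus>\<^bsub>L\<^esub> lie L a (lam b) \<ominus>\<^bsub>L\<^esub> lie L a (kap b))
    \<oplus>\<^bsub>L\<^esub> lam (kap a) \<oplus>\<^bsub>L\<^esub> lam (lam b)" for a b c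
  have D_closed: "D a \<in> carrier L" if "a \<in> carrier L" for a
    using that by (simp add: D_def br closed)
  have K_closed: "K a b c \<in> carrier L" if "a \<in> carrier L" "b \<in> carrier L" "c \<in> carrier L" for a b c
    using that by (simp add: K_def closed)
  have bracket_bracket: "bracket ?A a (bracket ?A b c)
      = D a \<oplus>\<^bsub>L\<^esub> (lie L a (lie L b c) \<oplus>\<^bsub>L\<^esub> (K b c a \<ominus>\<^bsub>L\<^esub> K a b c))"
    if "a \<in> carrier L" "b \<in> carrier L" "c \<in> carrier L" for a b c
    using that linear_endo_zero[OF linear_endo_lie_right[of a]]
    by (simp add: lie_antisym[of "lam b" c] D_def K_def br closed expand lam_lie lie_kap_self lie_alternating
        linear_endo_zero[OF lam] M.difference_simps M.a_ac)
  show ?thesis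
  proof (intro lie_affgebra.intro affine_space_affgebra_of lie_affgebra_axioms.intro)
    fix b assume b: "b \<in> carrier ?A"
    show "affine_map F ?A ?A (\<lambda>a. bracket ?A a b)"
    proof (rule affine_map_linear_plus_constant)
      show "linear_endo F L (diff_endo L (\<lambda>a. lie L a b \<oplus>\<^bsub>L\<^esub> kap a) lam)"
        using b by (intro linear_endo_diff linear_endo_add linear_endo_lie_left kap lam) (simp add: carr)
      show "lam b \<oplus>\<^bsub>L\<^esub> s \<in> carrier L"
        using b by (simp add: carr closed)
      fix a assume "a \<in> carrier L"
      then show "bracket ?A a b
          = diff_endo L (\<lambda>a. lie L a b \<oplus>\<^bsub>L\<^esub> kap a) lam a \<oplus>\<^bsub>L\<^esub> (lam b \<oplus>\<^bsub>L\<^esub> s)"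
        using b by (simp add: br carr closed expand diff_endo_def M.difference_simps M.a_ac)
    qed
  next
    fix a assume a: "a \<in> carrier ?A"
    show "affine_map F ?A ?A (\<lambda>b. bracket ?A a b)"
    proof (rule affine_map_linear_plus_constant)
      show "linear_endo F L (\<lambda>b. lie L a b \<oplus>\<^bsub>L\<^esub> lam b)"
        using a by (intro linear_endo_add linear_endo_lie_right lam) (simp add: carr)
      show "kap a \<ominus>\<^bsub>L\<^esub> lam a \<oplus>\<^bsub>L\<^esub> s \<in> carrier L"
        using a by (simp add: carr closed)
      fix b assume "b \<in> carrier L"
      then show "bracket ?A a b
          = (lie L a b \<oplus>\<^bsub>L\<^esub> lam b) \<oplus>\<^bsub>L\<^esub> (kap a \<ominus>\<^bsub>L\<^esub> lam a \<oplus>\<^bsub>L\<^esub> s)"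
        using a by (simp add: br carr closed expand M.difference_simps M.a_ac)
    qed
  next
    fix a b assume "a \<in> carrier ?A" "b \<in> carrier ?A"
    then show "heap ?A (bracket ?A a b) (bracket ?A a a) (bracket ?A b a) = bracket ?A b b"
      using lie_antisym[of a b]
      by (simp add: br heap carr closed expand lie_alternating linear_endo_zero[OF lam]
          M.difference_simps M.a_ac)
  next
    fix a b c assume "a \<in> carrier ?A" "b \<in> carrier ?A" "c \<in> carrier ?A"
    then have abc: "a \<in> carrier L" "b \<in> carrier L" "c \<in> carrier L"
      by (simp_all add: carr)
    let ?u = "lie L a (lie L b c) \<oplus>\<^bsub>L\<^esub> (K b c a \<ominus>\<^bsub>L\<^esub> K a b c)"
    let ?v = "lie L b (lie L c a) \<oplus>\<^bsub>L\<^esub> (K c a b \<ominus>\<^bsub>L\<^esub> K b c a)"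
    let ?w = "lie L c (lie L a b) \<oplus>\<^bsub>L\<^esub> (K a b c \<ominus>\<^bsub>L\<^esub> K c a b)"
    have "?u \<oplus>\<^bsub>L\<^esub> ?v \<oplus>\<^bsub>L\<^esub> ?w = \<zero>\<^bsub>L\<^esub>"
      using abc by (intro M.cyclic_sum_coboundary jacobi) (simp_all add: closed K_closed)
    moreover have "?u \<in> carrier L" "?v \<in> carrier L" "?w \<in> carrier L"
      using abc by (simp_all add: closed K_closed)
    ultimately have "heap ?A (heap ?A (D a \<oplus>\<^bsub>L\<^esub> ?u) (D a) (D b \<oplus>\<^bsub>L\<^esub> ?v)) (D b) (D c \<oplus>\<^bsub>L\<^esub> ?w) = D c"
      using abc unfolding heap by (intro M.telescope) (simp_all add: D_closed)
    then show "heap ?A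
          (heap ?A (bracket ?A a (bracket ?A b c)) (bracket ?A a (bracket ?A a a))
                   (bracket ?A b (bracket ?A c a)))
          (bracket ?A b (bracket ?A b b))
          (bracket ?A c (bracket ?A a b))
        = bracket ?A c (bracket ?A c c)"
      using abc by (simp only: bracket_bracket D_def[symmetric])
  qed
qed

section \<open>The semidirect product\<close>

context lie_algebra
begin

lemma semidirect_simps:
  "carrier (semidirect F L d) = carrier L \<times> carrier F"
  "\<zero>\<^bsub>semidirect F L d\<^esub> = (\<zero>\<^bsub>L\<^esub>, \<zero>)"
  "(x, \<alpha>) \<oplus>\<^bsub>semidirect F L d\<^esub> (y, \<beta>) = (x \<oplus>\<^bsub>L\<^esub> y, \<alpha> \<oplus> \<beta>)"
  "c \<odot>\<^bsub>semidirect F L d\<^esub> (x, \<alpha>) = (c \<odot>\<^bsub>L\<^esub> x, c \<otimes> \<alpha>)"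
  "lie (semidirect F L d) (x, \<alpha>) (y, \<beta>)
    = (lie L x y \<oplus>\<^bsub>L\<^esub> \<alpha> \<odot>\<^bsub>L\<^esub> d y \<ominus>\<^bsub>L\<^esub> \<beta> \<odot>\<^bsub>L\<^esub> d x, \<zero>)"
  by (simp_all add: semidirect_def)

lemma abelian_group_semidirect: "abelian_group (semidirect F L d)"
proof (rule abelian_groupI)
  fix p assume "p \<in> carrier (semidirect F L d)"
  then obtain x \<alpha> where p: "p = (x, \<alpha>)" "x \<in> carrier L" "\<alpha> \<in> carrier F"
    by (auto simp: semidirect_simps)
  then show "\<exists>q\<in>carrier (semidirect F L d). q \<oplus>\<^bsub>semidirect F L d\<^esub> p = \<zero>\<^bsub>semidirect F L d\<^esub>"
    by (intro bexI[of _ "(\<ominus>\<^bsub>L\<^esub> x, \<ominus> \<alpha>)"]) (auto simp: semidirect_simps M.l_neg R.l_neg)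
qed (auto simp: semidirect_simps M.a_ac R.a_ac)

lemma semidirect_minus:
  assumes "x \<in> carrier L" "y \<in> carrier L" "\<alpha> \<in> carrier F" "\<beta> \<in> carrier F"
  shows "(x, \<alpha>) \<ominus>\<^bsub>semidirect F L d\<^esub> (y, \<beta>) = (x \<ominus>\<^bsub>L\<^esub> y, \<alpha> \<ominus> \<beta>)"
proof -
  interpret G: abelian_group "semidirect F L d"
    by (rule abelian_group_semidirect)
  show ?thesis
    using assms
    by (simp add: G.minus_eq_iff semidirect_simps M.difference_simps R.difference_simps M.a_ac R.a_ac)
qed

text \<open>
  As bracketing with \<open>\<delta>\<close> is a derivation, the terms of the Jacobi sum that are linear in the scalars
  cancel, and the terms \<open>\<alpha>\<beta> \<delta>(\<delta>(z)) - \<alpha>\<gamma> \<delta>(\<delta>(y))\<close> cancel cyclically.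
\<close>

lemma lie_algebra_semidirect:
  assumes d: "derivation F L d"
  shows "lie_algebra F (semidirect F L d)"
proof -
  let ?G = "semidirect F L d"
  have lin: "linear_endo F L d"
    and d_lie: "\<And>x y. x \<in> carrier L \<Longrightarrow> y \<in> carrier L \<Longrightarrow>
      d (lie L x y) = lie L (d x) y \<oplus>\<^bsub>L\<^esub> lie L x (d y)"
    using d by (auto simp: derivation_def)
  note d_simps = linear_endoD[OF lin] linear_endo_minus[OF lin]
  note lie_simps = lie_closed lie_add_left lie_add_right lie_smult_left lie_smult_right
    lie_minus_left lie_minus_right lie_alternating
  \<comment> \<open>The derivation rule turns \<open>\<alpha>\<delta>[y, z]\<close> into \<open>\<alpha>[y, \<delta>(z)] - \<alpha>[z, \<delta>(y)]\<close>. Shifting the arguments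
    cyclically takes \<open>\<gamma>[x, \<delta>(y)]\<close> to \<open>\<alpha>[y, \<delta>(z)]\<close>, \<open>\<alpha>[z, \<delta>(y)]\<close> to \<open>\<beta>[x, \<delta>(z)]\<close> and
    \<open>\<alpha>\<gamma> \<delta>(\<delta>(y))\<close> to \<open>\<alpha>\<beta> \<delta>(\<delta>(z))\<close>.\<close>
  define K where "K \<alpha> \<gamma> x y z =
    \<alpha> \<odot>\<^bsub>L\<^esub> lie L z (d y) \<oplus>\<^bsub>L\<^esub> \<gamma> \<odot>\<^bsub>L\<^esub> lie L x (d y) \<oplus>\<^bsub>L\<^esub> \<alpha> \<odot>\<^bsub>L\<^esub> (\<gamma> \<odot>\<^bsub>L\<^esub> d (d y))" for \<alpha> \<gamma> x y z
  have K_closed: "K \<alpha> \<gamma> x y z \<in> carrier L"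
    if "x \<in> carrier L" "y \<in> carrier L" "z \<in> carrier L" "\<alpha> \<in> carrier F" "\<gamma> \<in> carrier F"
    for x y z \<alpha> \<gamma>
    using that by (simp add: K_def lie_closed d_simps)
  have "module F ?G"
    by (rule moduleI)
      (auto simp: R.is_cring abelian_group_semidirect semidirect_simps smult_l_distr smult_r_distr
        smult_assoc1 R.l_distr R.r_distr R.m_assoc)
  moreover have "lie_algebra_axioms F ?G"
  proof (rule lie_algebra_axioms.intro)
    fix p q r
    assume "p \<in> carrier ?G" "q \<in> carrier ?G" "r \<in> carrier ?G"
    then obtain x \<alpha> y \<beta> z \<gamma> where p: "p = (x, \<alpha>)" "q = (y, \<beta>)" "r = (z, \<gamma>)"
      and xyz: "x \<in> carrier L" "y \<in> carrier L" "z \<in> carrier L"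
      and \<alpha>\<beta>\<gamma>: "\<alpha> \<in> carrier F" "\<beta> \<in> carrier F" "\<gamma> \<in> carrier F"
      by (auto simp: semidirect_simps)
    have nested: "lie ?G (x, \<alpha>) (lie ?G (y, \<beta>) (z, \<gamma>))
        = (lie L x (lie L y z) \<oplus>\<^bsub>L\<^esub> (K \<beta> \<alpha> y z x \<ominus>\<^bsub>L\<^esub> K \<alpha> \<gamma> x y z), \<zero>)"
      if "x \<in> carrier L" "y \<in> carrier L" "z \<in> carrier L"
        "\<alpha> \<in> carrier F" "\<beta> \<in> carrier F" "\<gamma> \<in> carrier F" for x y z \<alpha> \<beta> \<gamma>
      using that
      by (simp add: lie_antisym[of "d y" z] K_def semidirect_simps d_simps d_lie lie_simps smult_r_minus smult_left_commute
          smult_minus_right smult_r_distr M.difference_simps M.a_ac)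
    show "lie ?G p (lie ?G q r) \<oplus>\<^bsub>?G\<^esub> lie ?G q (lie ?G r p) \<oplus>\<^bsub>?G\<^esub> lie ?G r (lie ?G p q) = \<zero>\<^bsub>?G\<^esub>"
      using xyz \<alpha>\<beta>\<gamma>
      by (simp only: p nested)
        (simp add: semidirect_simps M.cyclic_sum_coboundary jacobi K_closed lie_closed)
  qed (auto simp: semidirect_simps d_simps lie_simps module_simps smult_left_commute)
  ultimately show ?thesis
    by (intro lie_algebra.intro field_axioms)
qed

lemma lie_affgebra_data_scalar:
  assumes "k \<in> carrier F" "s \<in> carrier L"
  shows "lie_affgebra_data F L (scalar_endo L k) (scalar_endo L k) s"
  using assms linear_endo_scalar[OF assms(1)] lie_algebra_axioms
  by (auto simp: lie_affgebra_data_def scalar_endo_def lie_smult_left lie_smult_right lie_closed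
      M.difference_simps M.a_ac)

end

text \<open>
  For \<open>\<kappa>\<close> a scalar \<open>k\<close>, the compatibility condition is \<open>\<lambda>[a, b] = [\<lambda>(a), b] + [a, \<lambda>(b)] - k[a, b]\<close>.
  Subtracting \<open>k[a, b]\<close> leaves one correction \<open>-k[a, b]\<close> for each of the two summands.
\<close>

lemma derivation_diff_scalar:
  assumes data: "lie_affgebra_data F L (scalar_endo L k) lam s" and k: "k \<in> carrier F"
  shows "derivation F L (diff_endo L lam (scalar_endo L k))"
proof -
  interpret lie_algebra F L
    using data by (simp add: lie_affgebra_data_def)
  have lam: "linear_endo F L lam"
    and lam_lie: "\<And>a b. a \<in> carrier L \<Longrightarrow> b \<in> carrier L \<Longrightarrow>
      lam (lie L a b) = lie L (lam a) b \<ominus>\<^bsub>L\<^esub> lie L a (k \<odot>\<^bsub>L\<^esub> b) \<oplus>\<^bsub>L\<^esub> lie L a (lam b)"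
    using data by (auto simp: lie_affgebra_data_def scalar_endo_def)
  show ?thesis
    using k linear_endoD(1)[OF lam] linear_endo_diff[OF lam linear_endo_scalar[OF k]]
    by (auto simp: derivation_def diff_endo_def scalar_endo_def lam_lie lie_closed lie_smult_left
        lie_smult_right lie_minus_left lie_minus_right M.difference_simps M.a_ac)
qed

section \<open>The affine hyperplane at height one\<close>

lemma affgebra_iso_trans:
  assumes "affgebra_iso F A B" "affgebra_iso F B C"
  shows "affgebra_iso F A C"
proof -
  obtain f g where f: "affine_map F A B f" "bij_betw f (carrier A) (carrier B)"
      "\<And>a b. a \<in> carrier A \<Longrightarrow> b \<in> carrier A \<Longrightarrow> f (bracket A a b) = bracket B (f a) (f b)"
    and g: "affine_map F B C g" "bij_betw g (carrier B) (carrier C)"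
      "\<And>a b. a \<in> carrier B \<Longrightarrow> b \<in> carrier B \<Longrightarrow> g (bracket B a b) = bracket C (g a) (g b)"
    using assms by (auto simp: affgebra_iso_def)
  have "affine_map F A C (g \<circ> f)"
    using f(1) g(1) by (fastforce simp: affine_map_def Pi_iff)
  moreover have "bij_betw (g \<circ> f) (carrier A) (carrier C)"
    using f(2) g(2) by (rule bij_betw_trans)
  moreover have "(g \<circ> f) (bracket A a b) = bracket C ((g \<circ> f) a) ((g \<circ> f) b)"
    if "a \<in> carrier A" "b \<in> carrier A" for a b
    using that f(3) g(3) bij_betwE[OF f(2)] by simp
  ultimately show ?thesis
    unfolding affgebra_iso_def by blast
qed

context lie_algebra
begin

context
  fixes d :: "'c \<Rightarrow> 'c" and k :: 'a and s :: 'c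
  assumes d: "derivation F L d" and k: "k \<in> carrier F" and s: "s \<in> carrier L"
begin

abbreviation "G \<equiv> semidirect F L d"

abbreviation "B \<equiv> affgebra_of F G (scalar_endo G k) (scalar_endo G k) (s, \<one> \<ominus> k)"

lemma heap_at_height_one:
  assumes "x \<in> carrier L" "y \<in> carrier L" "z \<in> carrier L"
  shows "heap B (x, \<one>) (y, \<one>) (z, \<one>) = (x \<ominus>\<^bsub>L\<^esub> y \<oplus>\<^bsub>L\<^esub> z, \<one>)"
  using assms by (simp add: affgebra_of_def semidirect_minus semidirect_simps R.difference_simps)

lemma act_at_height_one:
  assumes "\<alpha> \<in> carrier F" "x \<in> carrier L" "y \<in> carrier L"
  shows "act B \<alpha> (x, \<one>) (y, \<one>) = ((\<one> \<ominus> \<alpha>) \<odot>\<^bsub>L\<^esub> x \<oplus>\<^bsub>L\<^esub> \<alpha> \<odot>\<^bsub>L\<^esub> y, \<one>)"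
  using assms by (simp add: affgebra_of_def semidirect_simps R.difference_simps)

text \<open>
  The second component is \<open>k\<close> from \<open>k(x + \<delta>)\<close> and \<open>\<one> \<ominus> k\<close> from the constant; the Lie bracket and
  \<open>k\<close> times the difference of the points contribute zero.
\<close>

lemma bracket_at_height_one:
  assumes "x \<in> carrier L" "y \<in> carrier L"
  shows "bracket B (x, \<one>) (y, \<one>)
    = (lie L x y \<oplus>\<^bsub>L\<^esub> k \<odot>\<^bsub>L\<^esub> x \<oplus>\<^bsub>L\<^esub> (d (y \<ominus>\<^bsub>L\<^esub> x) \<oplus>\<^bsub>L\<^esub> k \<odot>\<^bsub>L\<^esub> (y \<ominus>\<^bsub>L\<^esub> x)) \<oplus>\<^bsub>L\<^esub> s, \<one>)"
proof -
  have lin: "linear_endo F L d"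
    using d by (simp add: derivation_def)
  show ?thesis
    using assms k s linear_endoD(1)[OF lin]
    by (simp add: affgebra_of_def scalar_endo_def semidirect_minus semidirect_simps lie_closed
        linear_endo_minus[OF lin] smult_minus_right M.difference_simps R.difference_simps
        M.a_ac R.a_ac)
qed

lemma lie_subaffgebra_delta_translate: "lie_subaffgebra F (delta_translate F L) B"
proof -
  interpret G: lie_algebra F G
    using d by (rule lie_algebra_semidirect)
  have "lie_affgebra_data F G (scalar_endo G k) (scalar_endo G k) (s, \<one> \<ominus> k)"
    using k s by (intro G.lie_affgebra_data_scalar) (simp_all add: semidirect_simps)
  then have "lie_affgebra F B"
    by (rule lie_affgebra_affgebra_of)
  moreover have "carrier B = carrier L \<times> carrier F"
    by (simp add: affgebra_of_def semidirect_simps)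
  moreover have "d x \<in> carrier L" if "x \<in> carrier L" for x
    using d that linear_endoD(1) by (auto simp: derivation_def)
  ultimately show ?thesis
    using k s
    by (auto simp: lie_subaffgebra_def delta_translate_def heap_at_height_one act_at_height_one
        bracket_at_height_one lie_closed)
qed

lemma affgebra_iso_delta_translate:
  assumes lam: "\<And>x. x \<in> carrier L \<Longrightarrow> lam x = d x \<oplus>\<^bsub>L\<^esub> k \<odot>\<^bsub>L\<^esub> x"
  shows "affgebra_iso F (affgebra_of F L (scalar_endo L k) lam s) (B\<lparr>carrier := delta_translate F L\<rparr>)"
proof -
  let ?A = "affgebra_of F L (scalar_endo L k) lam s" and ?D = "B\<lparr>carrier := delta_translate F L\<rparr>"
  let ?f = "\<lambda>x. (x, \<one>)"
  have "affine_map F ?A ?D ?f"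
    using heap_at_height_one act_at_height_one
    by (auto simp: affine_map_def delta_translate_def affgebra_of_def)
  moreover have "bij_betw ?f (carrier ?A) (carrier ?D)"
    by (auto simp: bij_betw_def inj_on_def delta_translate_def affgebra_of_def)
  moreover have "?f (bracket ?A a b) = bracket ?D (?f a) (?f b)"
    if "a \<in> carrier ?A" "b \<in> carrier ?A" for a b
  proof -
    have ab: "a \<in> carrier L" "b \<in> carrier L"
      using that by (simp_all add: affgebra_of_def)
    have "bracket ?D (?f a) (?f b) = bracket B (?f a) (?f b)"
      by (simp add: affgebra_of_def)
    also have "\<dots> = ?f (bracket ?A a b)"
      using ab by (simp only: bracket_at_height_one) (simp add: affgebra_of_def scalar_endo_def lam)
    finally show ?thesis
      by simp
  qed
  ultimately show ?thesis
    unfolding affgebra_iso_def by blast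
qed

end

end

theorem proposition4p3:
  fixes F :: "('f, 'm) ring_scheme"
    and A :: "('f, 'p) affgebra"
    and L :: "('f, 'v) lie_alg"
    and k :: 'f and lam :: "'v \<Rightarrow> 'v" and s :: 'v
  assumes "field F" and "\<one>\<^bsub>F\<^esub> \<oplus>\<^bsub>F\<^esub> \<one>\<^bsub>F\<^esub> \<noteq> \<zero>\<^bsub>F\<^esub>"
    and "lie_affgebra F A" and "derivation_type F A"
    and "k \<in> carrier F"
    and "lie_affgebra_data F L (scalar_endo L k) lam s"
    and "affgebra_iso F A (affgebra_of F L (scalar_endo L k) lam s)"
  shows
    "let \<delta> = diff_endo L lam (scalar_endo L k);
         G = semidirect F L \<delta>;
         s' = (s, \<one>\<^bsub>F\<^esub> \<ominus>\<^bsub>F\<^esub> k);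
         B = affgebra_of F G (scalar_endo G k) (scalar_endo G k) s'
     in derivation F L \<delta> \<and>
        lie_affgebra_data F G (scalar_endo G k) (scalar_endo G k) s' \<and>
        lie_subaffgebra F (delta_translate F L) B \<and>
        affgebra_iso F A (B\<lparr>carrier := delta_translate F L\<rparr>)"
proof -
  interpret L: lie_algebra F L
    using assms(6) by (simp add: lie_affgebra_data_def)
  have s: "s \<in> carrier L" and lam: "linear_endo F L lam"
    using assms(6) by (simp_all add: lie_affgebra_data_def)
  define \<delta> where "\<delta> = diff_endo L lam (scalar_endo L k)"
  have der: "derivation F L \<delta>"
    unfolding \<delta>_def using assms(6,5) by (rule derivation_diff_scalar)
  interpret G: lie_algebra F "semidirect F L \<delta>"
    using der by (rule L.lie_algebra_semidirect)
  have data: "lie_affgebra_data F (semidirect F L \<delta>) (scalar_endo (semidirect F L \<delta>) k)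
      (scalar_endo (semidirect F L \<delta>) k) (s, \<one>\<^bsub>F\<^esub> \<ominus>\<^bsub>F\<^esub> k)"
    using assms(5) s by (intro G.lie_affgebra_data_scalar) (simp_all add: L.semidirect_simps)
  have "lam x = \<delta> x \<oplus>\<^bsub>L\<^esub> k \<odot>\<^bsub>L\<^esub> x" if "x \<in> carrier L" for x
    using that assms(5) linear_endoD(1)[OF lam that]
    by (simp add: \<delta>_def diff_endo_def scalar_endo_def L.M.difference_simps)
  then have iso: "affgebra_iso F A
      ((affgebra_of F (semidirect F L \<delta>) (scalar_endo (semidirect F L \<delta>) k)
        (scalar_endo (semidirect F L \<delta>) k) (s, \<one>\<^bsub>F\<^esub> \<ominus>\<^bsub>F\<^esub> k))\<lparr>carrier := delta_translate F L\<rparr>)"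
    using assms(7) L.affgebra_iso_delta_translate[OF der assms(5) s] by (blast intro: affgebra_iso_trans)
  show ?thesis
    using der data iso L.lie_subaffgebra_delta_translate[OF der assms(5) s]
    by (simp add: Let_def \<delta>_def)
qed

end
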